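(* Let $n\ge1$ and let $\mathcal{B}$ be the set of bases of the trivial unit interval positroid $\mathcal{P}_n$ of rank $n$ on $[2n]$. Let $\gamma(\mathcal{B})$ be the collection of sets produced as follows: (1) for each $B\in\mathcal{B}$, the set $(B+1)\cup\{\min B\}$, where $B+1=\{b+1:b\in B\}$; (2) for each set $S$ from step (1) with $2n+1\in S$, the set $(S\setminus\{2n+1\})\cup\{2n+2\}$; (3) for each set $S$ from steps (1) and (2) with $2\in S$, the set $(S\setminus\{2\})\cup\{1\}$. Then $\gamma(\mathcal{B})$ is exactly the set of bases of the trivial unit interval positroid $\mathcal{P}_{n+1}$ of rank $n+1$ on $[2(n+1)]$.
   Context: For $m\ge1$, the trivial unit interval positroid $\mathcal{P}_m$ is the matroid on $[2m]=\{1,\dots,2m\}$ whose bases are the index sets of maximal linearly independent sets of columns of the real $m\times 2m$ matrix whose first $m$ columns form the identity matrix $I_m$ and each of whose columns $m+1,\dots,2m$ equals the vector with entry $(-1)^{m-i}$ in row $i$.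
   Formalization: Step (3) is applied only to sets S with 2 in S and 1 not in S; read literally the claim fails for every n, since B = [n] gives S = [n+1] and then {1,3,...,n+1}, which has only n elements and is not a basis of P_{n+1}. *)

theory Defs
  imports "Jordan_Normal_Form.VS_Connect"
begin

(* Library matrices are indexed from 0: entry (i, j) here is the entry in row i + 1 and
   column j + 1 of the informal matrix, so the exponent m - (i + 1) becomes m - Suc i
   (no truncation, as i < m). *)
definition unit_interval_matrix :: "nat \<Rightarrow> real mat" where
  "unit_interval_matrix m = mat m (2 * m)
     (\<lambda>(i, j). if j < m then (if i = j then 1 else 0) else (-1) ^ (m - Suc i))"

(* I is a set of column indices counted from 1.  Independence is that of the family of
   columns indexed by I; since the library predicate concerns sets of vectors, injectivity
   is needed to make repeated columns count as dependent. *)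
definition indep_columns :: "real mat \<Rightarrow> nat set \<Rightarrow> bool" where
  "indep_columns A I \<longleftrightarrow> I \<subseteq> {1..dim_col A} \<and> inj_on (\<lambda>j. col A (j - 1)) I \<and>
     \<not> module.lin_dep class_ring (module_vec TYPE(real) (dim_row A)) ((\<lambda>j. col A (j - 1)) ` I)"

definition column_bases :: "real mat \<Rightarrow> nat set set" where
  "column_bases A = {I. indep_columns A I \<and> (\<forall>J. indep_columns A J \<and> I \<subseteq> J \<longrightarrow> J = I)}"

definition trivial_positroid_bases :: "nat \<Rightarrow> nat set set" where
  "trivial_positroid_bases m = column_bases (unit_interval_matrix m)"

definition gamma_shift :: "nat set set \<Rightarrow> nat set set" where
  "gamma_shift \<B> = {(\<lambda>b. b + 1) ` B \<union> {Min B} | B. B \<in> \<B>}"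

definition gamma_top :: "nat \<Rightarrow> nat set set \<Rightarrow> nat set set" where
  "gamma_top n \<S> = {(S - {2 * n + 1}) \<union> {2 * n + 2} | S. S \<in> \<S> \<and> 2 * n + 1 \<in> S}"

(* Replacing 2 by 1 is an exchange of elements, so it applies only when 1 is not yet in S.
   If 1 and 2 are both in S, then (S - {2}) \<union> {1} = S - {2} has one element fewer than S and
   is never a basis.  For example, n = 1 and B = {1} give S = {1, 2} and then {1}, but the
   second positroid has rank 2.  The unions in the other two steps are always disjoint. *)
definition gamma_bottom :: "nat set set \<Rightarrow> nat set set" where
  "gamma_bottom \<S> = {(S - {2}) \<union> {1} | S. S \<in> \<S> \<and> 2 \<in> S \<and> 1 \<notin> S}"

definition gamma :: "nat \<Rightarrow> nat set set \<Rightarrow> nat set set" where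
  "gamma n \<B> =
     (let S1 = gamma_shift \<B>; S2 = gamma_top n S1; S3 = gamma_bottom (S1 \<union> S2)
      in S1 \<union> S2 \<union> S3)"

end

(* Write v for the common value of the last m columns of the matrix. Two copies of v are
   dependent, and v has no zero entry, so v may replace exactly one unit vector, but any one
   of them. Hence the bases are [m] and the sets [m] - {i} + j with i \<le> m < j \<le> 2 * m. In these
   terms, the shift sends [n] to [n + 1] and (i, j) to (i + 1, j + 1), except that it sends
   (1, j) to (1, j + 1); the second step supplies j = 2 * n + 2 and the third i = 2. *)
theory Submission
  imports Defs
begin

section \<open>Linear independence of a family of columns\<close>

text \<open>Coefficients indexed by column numbers instead of vectors absorb the injectivity clause:
  equal columns at two distinct indices already satisfy a relation with coefficients 1 and -1.
  Independence becomes a system of scalar equations, one per row.\<close>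

lemma indep_columns_iff:
  fixes A :: "real mat"
  shows "indep_columns A I \<longleftrightarrow> I \<subseteq> {1..dim_col A} \<and>
    (\<forall>c. (\<forall>r<dim_row A. (\<Sum>j\<in>I. c j * A $$ (r, j - 1)) = 0) \<longrightarrow> (\<forall>j\<in>I. c j = 0))"
proof (cases "I \<subseteq> {1..dim_col A}")
  case False
  then show ?thesis by (simp add: indep_columns_def)
next
  case True
  interpret vec_space "TYPE(real)" "dim_row A" .
  define f where "f j = col A (j - 1)" for j
  have fin: "finite I" using True finite_subset by blast
  have fC: "f ` I \<subseteq> carrier_vec (dim_row A)" by (auto simp: f_def carrier_dim_vec)
  have entry: "f j $ r = A $$ (r, j - 1)" if "j \<in> I" "r < dim_row A" for j r
  proof -
    have "j - 1 < dim_col A" using that True by fastforce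
    then show ?thesis using that by (simp add: f_def)
  qed
  have lincomb: "lincomb a (f ` I) $ r = (\<Sum>j\<in>I. a (f j) * A $$ (r, j - 1))"
    if "inj_on f I" "r < dim_row A" for a r
    using that entry lincomb_index[OF that(2) fC, of a] by (simp add: sum.reindex)
  have "inj_on f I \<and> lin_indpt (f ` I) \<longleftrightarrow>
    (\<forall>c. (\<forall>r<dim_row A. (\<Sum>j\<in>I. c j * A $$ (r, j - 1)) = 0) \<longrightarrow> (\<forall>j\<in>I. c j = 0))"
    (is "_ \<longleftrightarrow> ?R")
  proof safe
    fix c j
    assume inj: "inj_on f I" and li: "lin_indpt (f ` I)" and j: "j \<in> I"
      and c: "\<forall>r<dim_row A. (\<Sum>j\<in>I. c j * A $$ (r, j - 1)) = 0"
    \<comment> \<open>\<open>lincomb\<close> takes coefficients attached to vectors, so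
      \<open>c\<close> is transported along the inverse of \<open>f\<close>, which exists on the
      image by injectivity.\<close>
    define a where "a = c \<circ> the_inv_into I f"
    have a: "a (f i) = c i" if "i \<in> I" for i
      using that inj by (simp add: a_def the_inv_into_f_f)
    have "lincomb a (f ` I) = 0\<^sub>v (dim_row A)"
    proof (rule eq_vecI)
      show "dim_vec (lincomb a (f ` I)) = dim_vec (0\<^sub>v (dim_row A))"
        using lincomb_dim[OF _ fC] fin by simp
    qed (use lincomb[OF inj] c in \<open>simp add: a\<close>)
    then show "c j = 0"
      using li fin j a unfolding lin_dep_def
      by (metis (no_types, lifting) finite_imageI image_eqI order_refl Pi_I UNIV_I)
  next
    assume R: ?R
    show inj: "inj_on f I"
    proof (rule inj_onI, rule ccontr)
      fix i j assume ij: "i \<in> I" "j \<in> I" "f i = f j" "i \<noteq> j"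
      define c :: "nat \<Rightarrow> real" where "c k = (if k = i then 1 else if k = j then -1 else 0)" for k
      have "(\<Sum>k\<in>I. c k * A $$ (r, k - 1)) = 0" if "r < dim_row A" for r
      proof -
        have "(\<Sum>k\<in>I. c k * A $$ (r, k - 1)) = (\<Sum>k\<in>{i,j}. c k * A $$ (r, k - 1))"
          by (rule sum.mono_neutral_right) (use fin ij in \<open>auto simp: c_def\<close>)
        also have "\<dots> = f i $ r - f j $ r"
          unfolding entry[OF ij(1) that] entry[OF ij(2) that] using ij by (simp add: c_def)
        finally show ?thesis using ij by simp
      qed
      then have "c i = 0" using R ij(1) by blast
      then show False by (simp add: c_def)
    qed
    assume "lin_dep (f ` I)"
    then obtain a v where a: "lincomb a (f ` I) = 0\<^sub>v (dim_row A)" "v \<in> f ` I" "a v \<noteq> 0"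
      using finite_lin_dep[OF _ _ fC] fin by auto
    have "(\<Sum>j\<in>I. a (f j) * A $$ (r, j - 1)) = 0" if "r < dim_row A" for r
      using lincomb[OF inj that, of a] a(1) that by simp
    then have "\<forall>j\<in>I. a (f j) = 0" using R[rule_format, of "\<lambda>j. a (f j)"] by blast
    then show False using a by blast
  qed
  moreover have "f = (\<lambda>j. col A (j - 1))" by (simp add: f_def fun_eq_iff)
  ultimately show ?thesis using True unfolding indep_columns_def by meson
qed

section \<open>Independent column sets and bases of the unit interval matrix\<close>

lemma unit_interval_matrix_dim [simp]:
  "dim_row (unit_interval_matrix m) = m" "dim_col (unit_interval_matrix m) = 2 * m"
  by (simp_all add: unit_interval_matrix_def)

lemma unit_interval_matrix_left:
  "r < m \<Longrightarrow> k \<in> {1..m} \<Longrightarrow>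
    unit_interval_matrix m $$ (r, k - 1) = (if k = Suc r then 1 else 0)"
  by (auto simp: unit_interval_matrix_def)

lemma unit_interval_matrix_right:
  "r < m \<Longrightarrow> j \<in> {m+1..2*m} \<Longrightarrow>
    unit_interval_matrix m $$ (r, j - 1) = (-1) ^ (m - Suc r)"
  by (auto simp: unit_interval_matrix_def)

text \<open>A row of the identity block has a single nonzero entry, in column \<open>Suc r\<close>
  when columns are counted from 1.\<close>

lemma unit_interval_matrix_left_sum:
  assumes "r < m" "I \<subseteq> {1..m}"
  shows "(\<Sum>k\<in>I. c k * unit_interval_matrix m $$ (r, k - 1)) = (if Suc r \<in> I then c (Suc r) else 0)"
proof -
  have "finite I" using assms finite_subset by blast
  have "(\<Sum>k\<in>I. c k * unit_interval_matrix m $$ (r, k - 1)) =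
      (\<Sum>k\<in>I. if k = Suc r then c k else 0)"
  proof (rule sum.cong)
    fix k assume "k \<in> I"
    then have "k \<in> {1..m}" using assms by blast
    then show "c k * unit_interval_matrix m $$ (r, k - 1) = (if k = Suc r then c k else 0)"
      unfolding unit_interval_matrix_left[OF assms(1) \<open>k \<in> {1..m}\<close>] by simp
  qed simp
  then show ?thesis using \<open>finite I\<close> by simp
qed

lemma indep_unit_columns: "indep_columns (unit_interval_matrix m) {1..m}"
  unfolding indep_columns_iff
proof (intro conjI allI impI ballI)
  fix c k
  assume c: "\<forall>r<dim_row (unit_interval_matrix m).
      (\<Sum>j\<in>{1..m}. c j * unit_interval_matrix m $$ (r, j - 1)) = 0" and k: "k \<in> {1..m}"
  then have "k - 1 < m" "Suc (k - 1) = k" by auto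
  then show "c k = 0"
    using c k unit_interval_matrix_left_sum[of "k - 1" m "{1..m}" c] by auto
qed auto

text \<open>The row of the removed unit column \<open>i\<close> involves only \<open>c j\<close>,
  with coefficient 1 or -1, so \<open>c j = 0\<close>; every other row then gives the vanishing of
  its own \<open>c k\<close>.\<close>

lemma indep_exchange_columns:
  assumes i: "i \<in> {1..m}" and j: "j \<in> {m+1..2*m}"
  shows "indep_columns (unit_interval_matrix m) (insert j ({1..m} - {i}))"
  unfolding indep_columns_iff
proof (intro conjI allI impI)
  show "insert j ({1..m} - {i}) \<subseteq> {1..dim_col (unit_interval_matrix m)}" using j by auto
  fix c
  assume c: "\<forall>r<dim_row (unit_interval_matrix m).
      (\<Sum>j\<in>insert j ({1..m} - {i}). c j * unit_interval_matrix m $$ (r, j - 1)) = 0"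
  have row: "c j * (-1) ^ (m - k) + (if k = i then 0 else c k) = 0" if "k \<in> {1..m}" for k
  proof -
    have k: "k - 1 < m" "Suc (k - 1) = k" using that by auto
    have "j \<notin> {1..m} - {i}" using j by auto
    then show ?thesis
      using c[rule_format, of "k - 1"] k that
        unit_interval_matrix_left_sum[of "k - 1" m "{1..m} - {i}" c]
        unit_interval_matrix_right[OF k(1) j]
      by auto
  qed
  have "c j = 0" using row[OF i] by simp
  then show "\<forall>k\<in>insert j ({1..m} - {i}). c k = 0" using row by (fastforce split: if_splits)
qed

text \<open>There are two obstructions: the columns on the right are all equal, so at most one of
  them occurs, and that one is a combination of all unit columns, so at least one of these is
  absent.\<close>

lemma indep_columns_subset_basis:
  assumes I: "indep_columns (unit_interval_matrix m) I"
  shows "I \<subseteq> {1..m} \<or> (\<exists>i\<in>{1..m}. \<exists>j\<in>{m+1..2*m}. I \<subseteq> insert j ({1..m} - {i}))"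
proof (cases "I \<subseteq> {1..m}")
  case False
  let ?U = "unit_interval_matrix m"
  have sub: "I \<subseteq> {1..2*m}" using I by (simp add: indep_columns_iff)
  obtain j where j: "j \<in> I" "j \<in> {m+1..2*m}" using False sub by fastforce
  have uniq: "k = j" if k: "k \<in> I" "k \<in> {m+1..2*m}" for k
  proof -
    have "k - 1 < 2 * m" "j - 1 < 2 * m" using j k by auto
    then have "col ?U (k - 1) = col ?U (j - 1)"
      by (intro eq_vecI)
        (simp_all add: unit_interval_matrix_right[OF _ j(2)] unit_interval_matrix_right[OF _ k(2)]
          del: One_nat_def)
    then show ?thesis using I j k unfolding indep_columns_def inj_on_def by blast
  qed
  have Ieq: "I = insert j (I \<inter> {1..m})"
  proof -
    have "k \<in> {1..m} \<or> k \<in> {m+1..2*m}" if "k \<in> I" for k using sub that by force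
    then show ?thesis using uniq j(1) by blast
  qed
  have "\<not> {1..m} \<subseteq> I"
  proof
    assume all: "{1..m} \<subseteq> I"
    then have Im: "I = insert j {1..m}" using Ieq by blast
    have jn: "j \<notin> {1..m}" using j by auto
    \<comment> \<open>Column \<open>j\<close> is the sum of the unit columns \<open>k\<close>
      weighted by \<open>(-1) ^ (m - k)\<close>; this is the resulting relation.\<close>
    define c :: "nat \<Rightarrow> real" where "c k = (if k = j then 1 else - ((-1) ^ (m - k)))" for k
    have "(\<Sum>k\<in>I. c k * ?U $$ (r, k - 1)) = 0" if "r < m" for r
    proof -
      have "Suc r \<noteq> j" using j that by auto
      then show ?thesis
        using jn that unit_interval_matrix_left_sum[OF that, of "{1..m}" c]
          unit_interval_matrix_right[OF that j(2)]
        by (simp add: Im c_def)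
    qed
    then have "c j = 0" using I j(1) unfolding indep_columns_iff unit_interval_matrix_dim by blast
    then show False by (simp add: c_def)
  qed
  then show ?thesis using Ieq j by blast
qed simp

text \<open>The listed sets are independent and every independent set lies in one of them. Since all
  have \<open>m\<close> elements, none properly contains another, so they are exactly the maximal
  independent sets.\<close>

lemma trivial_positroid_bases_eq:
  "trivial_positroid_bases m =
    insert {1..m} {insert j ({1..m} - {i}) | i j. i \<in> {1..m} \<and> j \<in> {m+1..2*m}}"
    (is "_ = ?T")
proof -
  let ?indep = "indep_columns (unit_interval_matrix m)"
  have indep: "?indep B" if "B \<in> ?T" for B
    using that indep_unit_columns indep_exchange_columns by blast
  have ext: "\<exists>B\<in>?T. I \<subseteq> B" if "?indep I" for I
    using indep_columns_subset_basis[OF that] by blast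
  have card: "finite B \<and> card B = m" if "B \<in> ?T" for B
    using that by auto
  have antichain: "B = C" if "B \<in> ?T" "C \<in> ?T" "B \<subseteq> C" for B C
    using card[OF that(1)] card[OF that(2)] that(3) card_subset_eq by metis
  have max: "J = B" if B: "B \<in> ?T" and J: "?indep J" "B \<subseteq> J" for B J
  proof -
    obtain C where "C \<in> ?T" "J \<subseteq> C" using ext[OF J(1)] by blast
    moreover from this have "B = C" using antichain[OF B] J(2) by blast
    ultimately show ?thesis using J(2) by blast
  qed
  show ?thesis
  proof (intro subset_antisym subsetI)
    fix I assume "I \<in> trivial_positroid_bases m"
    then have I: "?indep I" "\<And>J. ?indep J \<Longrightarrow> I \<subseteq> J \<Longrightarrow> J = I"
      by (auto simp: trivial_positroid_bases_def column_bases_def)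
    obtain B where "B \<in> ?T" "I \<subseteq> B" using ext[OF I(1)] by blast
    moreover from this have "B = I" using I(2) indep by blast
    ultimately show "I \<in> ?T" by blast
  next
    fix B assume "B \<in> ?T"
    then show "B \<in> trivial_positroid_bases m"
      unfolding trivial_positroid_bases_def column_bases_def mem_Collect_eq
      using indep[of B] max[of B] by (intro conjI allI impI) (assumption | blast)+
  qed
qed

section \<open>Effect of the shift on bases\<close>

lemma Suc_image_exchange:
  "Suc ` insert j ({1..n} - {i}) = insert (Suc j) ({2..Suc n} - {Suc i})"
proof -
  have "Suc ` ({1..n} - {i}) = Suc ` {1..n} - {Suc i}"
    by (simp add: image_set_diff)
  then show ?thesis by (simp add: image_Suc_atLeastAtMost numeral_2_eq_2)
qed

text \<open>For \<open>i \<noteq> 1\<close> the minimum is 1 and fills the place vacated by the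
  shift, so the gap moves to \<open>Suc i\<close>. For \<open>i = 1\<close> the minimum is 2, which
  fills the gap at 2 and leaves 1 missing. Hence 2 is never the missing index.\<close>

lemma shift_exchange:
  assumes i: "i \<in> {1..n}" and j: "j \<in> {n+1..2*n}"
  shows "(\<lambda>b. b + 1) ` insert j ({1..n} - {i}) \<union> {Min (insert j ({1..n} - {i}))} =
    insert (Suc j) ({1..n+1} - {if i = 1 then 1 else Suc i})"
proof (cases "i = 1")
  case True
  have "Min (insert j ({1..n} - {i})) = 2"
  proof (rule Min_eqI)
    \<comment> \<open>For \<open>n = 1\<close> no unit index is left, and 2 occurs as the only
      possible value of \<open>j\<close>.\<close>
    show "2 \<in> insert j ({1..n} - {i})" using i j True by (cases "n = 1") auto
  qed (use i j True in auto)
  then show ?thesis using True i j unfolding Suc_eq_plus1[symmetric] Suc_image_exchange by auto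
next
  case False
  have "Min (insert j ({1..n} - {i})) = 1"
    by (rule Min_eqI) (use i j False in auto)
  then show ?thesis using False i j unfolding Suc_eq_plus1[symmetric] Suc_image_exchange by auto
qed

text \<open>Fixing 1 and raising every other gap by one maps \<open>{1..n}\<close> onto
  \<open>{1..n+1} - {2}\<close>, and raising \<open>j\<close> by one maps \<open>{n+1..2*n}\<close>
  onto \<open>{n+2..2*n+1}\<close>.\<close>

lemma gamma_shift_bases:
  assumes "n \<ge> 1"
  shows "gamma_shift (trivial_positroid_bases n) =
    insert {1..n+1} {insert j ({1..n+1} - {i}) | i j. i \<in> {1..n+1} - {2} \<and> j \<in> {n+2..2*n+1}}"
    (is "_ = insert _ ?E")
proof -
  have base: "(\<lambda>b. b + 1) ` {1..n} \<union> {Min {1..n}} = {1..n+1}"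
  proof -
    have "Min {1..n} = 1" by (rule Min_eqI) (use assms in auto)
    then show ?thesis using assms by (auto simp: image_Suc_atLeastAtMost)
  qed
  let ?h = "\<lambda>B. (\<lambda>b. b + 1) ` B \<union> {Min B}"
  have "?h ` {insert j ({1..n} - {i}) | i j. i \<in> {1..n} \<and> j \<in> {n+1..2*n}} = ?E" (is "?h ` ?D = _")
  proof (intro subset_antisym subsetI)
    fix S assume "S \<in> ?h ` ?D"
    then obtain i j where ij: "i \<in> {1..n}" "j \<in> {n+1..2*n}"
      and S: "S = insert (Suc j) ({1..n+1} - {if i = 1 then 1 else Suc i})"
      using shift_exchange by auto
    have "(if i = 1 then 1 else Suc i) \<in> {1..n+1} - {2}" "Suc j \<in> {n+2..2*n+1}"
      using ij by auto
    then show "S \<in> ?E" using S by blast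
  next
    fix S assume "S \<in> ?E"
    then obtain i j where ij: "i \<in> {1..n+1} - {2}" "j \<in> {n+2..2*n+1}"
      and S: "S = insert j ({1..n+1} - {i})" by blast
    \<comment> \<open>This inverts the gap map: as \<open>i = 2\<close> is excluded,
      \<open>i' = 1\<close> arises only from \<open>i = 1\<close>.\<close>
    define i' where "i' = (if i = 1 then 1 else i - 1)"
    have i': "i' \<in> {1..n}" "(if i' = 1 then 1 else Suc i') = i"
      using ij assms by (auto simp: i'_def)
    have j': "j - 1 \<in> {n+1..2*n}" "Suc (j - 1) = j" using ij by auto
    have "S = ?h (insert (j - 1) ({1..n} - {i'}))"
      using shift_exchange[OF i'(1) j'(1)] unfolding i'(2) j'(2) S by simp
    then show "S \<in> ?h ` ?D" using i'(1) j'(1) by blast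
  qed
  moreover have "gamma_shift \<B> = ?h ` \<B>" for \<B> by (auto simp: gamma_shift_def)
  ultimately show ?thesis by (simp only: trivial_positroid_bases_eq image_insert base)
qed

section \<open>Completion of the bases by the top and bottom exchanges\<close>

theorem theorem4p4:
  fixes n :: nat
  assumes "n \<ge> 1"
  shows "gamma n (trivial_positroid_bases n) = trivial_positroid_bases (n + 1)"
proof -
  define X where "X i j = insert j ({1..n+1} - {i})" for i j
  define S1 where "S1 = gamma_shift (trivial_positroid_bases n)"
  define S2 where "S2 = gamma_top n S1"
  have S1: "S1 = insert {1..n+1} {X i j | i j. i \<in> {1..n+1} - {2} \<and> j \<in> {n+2..2*n+1}}"
    unfolding S1_def X_def by (rule gamma_shift_bases[OF assms])
  \<comment> \<open>Since \<open>2*n+1\<close> exceeds \<open>n+1\<close>, it can only be the right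
    index \<open>j\<close>.\<close>
  have top: "X i j - {2*n+1} \<union> {2*n+2} = X i (2*n+2)" if "2*n+1 \<in> X i j" "j \<ge> n+2" for i j
    using that assms by (auto simp: X_def)
  \<comment> \<open>The absence of 1 forces \<open>i = 1\<close>, so the exchange moves the gap from
    1 to 2.\<close>
  have bottom: "X i j - {2} \<union> {1} = X 2 j" if "1 \<notin> X i j" "j \<ge> n+2" for i j
    using that assms by (auto simp: X_def)
  have S2: "S2 = {X i (2*n+2) | i. i \<in> {1..n+1} - {2}}"
  proof (intro subset_antisym subsetI)
    fix S assume "S \<in> S2"
    then obtain T where T: "T \<in> S1" "2*n+1 \<in> T" "S = T - {2*n+1} \<union> {2*n+2}"
      unfolding S2_def gamma_top_def by blast
    have "T \<noteq> {1..n+1}" using T(2) assms by auto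
    then obtain i j where ij: "i \<in> {1..n+1} - {2}" "j \<in> {n+2..2*n+1}" "T = X i j"
      using T(1) unfolding S1 by blast
    then show "S \<in> {X i (2*n+2) | i. i \<in> {1..n+1} - {2}}"
      using top[of i j] T by auto
  next
    fix S assume "S \<in> {X i (2*n+2) | i. i \<in> {1..n+1} - {2}}"
    then obtain i where i: "i \<in> {1..n+1} - {2}" "S = X i (2*n+2)" by blast
    have j: "2*n+1 \<in> {n+2..2*n+1}" using assms by auto
    have "2*n+1 \<in> X i (2*n+1)" by (simp add: X_def)
    moreover have "X i (2*n+1) \<in> S1" using i j unfolding S1 by blast
    moreover have "S = X i (2*n+1) - {2*n+1} \<union> {2*n+2}" using calculation(1) i j top by auto
    ultimately show "S \<in> S2" unfolding S2_def gamma_top_def by blast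
  qed
  have S12: "S1 \<union> S2 = insert {1..n+1} {X i j | i j. i \<in> {1..n+1} - {2} \<and> j \<in> {n+2..2*n+2}}"
  proof -
    have J: "{n+2..2*n+2} = insert (2*n+2) {n+2..2*n+1}" by auto
    show ?thesis unfolding S1 S2 J by blast
  qed
  have S3: "gamma_bottom (S1 \<union> S2) = {X 2 j | j. j \<in> {n+2..2*n+2}}"
  proof (intro subset_antisym subsetI)
    fix S assume "S \<in> gamma_bottom (S1 \<union> S2)"
    then obtain T where T: "T \<in> S1 \<union> S2" "1 \<notin> T" "S = T - {2} \<union> {1}"
      unfolding gamma_bottom_def by blast
    have "T \<noteq> {1..n+1}" using T(2) by auto
    then obtain i j where ij: "j \<in> {n+2..2*n+2}" "T = X i j"
      using T(1) unfolding S12 by blast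
    then show "S \<in> {X 2 j | j. j \<in> {n+2..2*n+2}}"
      using bottom[of i j] T by auto
  next
    fix S assume "S \<in> {X 2 j | j. j \<in> {n+2..2*n+2}}"
    then obtain j where j: "j \<in> {n+2..2*n+2}" "S = X 2 j" by blast
    \<comment> \<open>The preimage is \<open>X 1 j\<close>. It is available for
      \<open>j = 2*n+2\<close> too because the bottom exchange also acts on the sets from the top
      exchange.\<close>
    have "1 \<in> {1..n+1} - {2}" by simp
    then have "X 1 j \<in> S1 \<union> S2" using j unfolding S12 by blast
    moreover have "1 \<notin> X 1 j" "2 \<in> X 1 j" using j assms by (auto simp: X_def)
    moreover have "S = X 1 j - {2} \<union> {1}" using bottom[of 1 j] j calculation by simp
    ultimately show "S \<in> gamma_bottom (S1 \<union> S2)" unfolding gamma_bottom_def by blast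
  qed
  have "gamma n (trivial_positroid_bases n) = S1 \<union> S2 \<union> gamma_bottom (S1 \<union> S2)"
    by (simp add: gamma_def Let_def S1_def S2_def)
  also have "\<dots> = insert {1..n+1} {X i j | i j. i \<in> {1..n+1} \<and> j \<in> {n+2..2*n+2}}"
  proof -
    \<comment> \<open>Gaps other than 2 come from \<open>S1 \<union> S2\<close>, the gap 2 from the
      bottom exchange; 2 lies in the range because \<open>n \<ge> 1\<close>.\<close>
    have I: "i \<in> {1..n+1} \<longleftrightarrow> i \<in> {1..n+1} - {2} \<or> i = 2" for i using assms by auto
    show ?thesis unfolding S3 unfolding S12 I by blast
  qed
  also have "\<dots> = trivial_positroid_bases (n + 1)"
    by (simp add: trivial_positroid_bases_eq X_def)
  finally show ?thesis .
qed

end
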